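(* Let $n, m, S$ be positive integers with $S \le n$, let $N = \lceil n/S \rceil$, and let $A \in \mathbb{R}^{n\times n}$ and $B \in \mathbb{R}^{n\times m}$ be such that the pair $(A,B)$ is stabilizable. Then there exist real parameters $g_1,\dots,g_N$ defining the class of sparsifiers $\mathcal{G}_S=\{G_1,\dots,G_N\}$, a feedback gain $\tilde K \in \mathbb{R}^{m\times n}$, and weights $\alpha_1,\dots,\alpha_N \ge 0$ with $\sum_{i=1}^{N}\alpha_i = 1$ such that, with $A_i = A - B\tilde K G_i$ for $i=1,\dots,N$, the convex combination $\overline{A} = \sum_{i=1}^{N} \alpha_i A_i$ is Hurwitz.
   Context: The plant is the continuous-time linear system $\dot x = Ax + Bu$ with $x\in\mathbb{R}^n$, $u \in \mathbb{R}^m$. The pair $(A,B)$ is stabilizable if there exists $K\in\mathbb{R}^{m\times n}$ such that $A-BK$ is Hurwitz; a real square matrix is Hurwitz if all its eigenvalues have strictly negative real part. Class of sparsifiers: for positive integers $S \le n$ and $N=\lceil n/S\rceil$, the class $\mathcal{G}_S = \{G_1,\dots,G_N\}$ with real parameters $g_1,\dots,g_N$ consists of the diagonal matrices $G_i\in\mathbb{R}^{n\times n}$ whose $j$-th diagonal entry equals $g_i$ if $(i-1)S+1 \le j \le \min(iS,n)$ and equals $0$ otherwise. Thus each $G_i$ has at least $n-S$ zeros on its diagonal, and the index blocks of $G_1,\dots,G_N$ partition $\{1,\dots,n\}$. Under the feedback $u = -\tilde K G_i x$ (the state is measured through the sparsifier $G_i$), the closed-loop subsystem is $\dot x = A_i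 x$ with $A_i = A - B\tilde K G_i$. *)

theory Defs
  imports "HOL.Complex" "Jordan_Normal_Form.Char_Poly"
begin

text \<open>The eigenvalues of a real matrix are the complex ones, hence the embedding into complex matrices.\<close>

definition hurwitz :: "real mat \<Rightarrow> bool" where
  "hurwitz M \<longleftrightarrow> square_mat M \<and>
     (\<forall>z. eigenvalue (map_mat complex_of_real M) z \<longrightarrow> Re z < 0)"

definition stabilizable :: "real mat \<Rightarrow> real mat \<Rightarrow> bool" where
  "stabilizable A B \<longleftrightarrow>
     (\<exists>K \<in> carrier_mat (dim_col B) (dim_row A). hurwitz (A - B * K))"

definition num_sparsifiers :: "nat \<Rightarrow> nat \<Rightarrow> nat" where
  "num_sparsifiers n S = nat \<lceil>real n / real S\<rceil>"

text \<open>The block index \<open>i\<close> runs over \<open>1, \<dots>, num_sparsifiers n S\<close>. Matrix positions are counted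
  from \<open>0\<close>, so the position \<open>j\<close> below is the diagonal entry with the 1-based index \<open>Suc j\<close>.\<close>

definition sparsifier :: "nat \<Rightarrow> nat \<Rightarrow> (nat \<Rightarrow> real) \<Rightarrow> nat \<Rightarrow> real mat" where
  "sparsifier n S g i =
     mat_diag n (\<lambda>j. if (i - 1) * S + 1 \<le> Suc j \<and> Suc j \<le> min (i * S) n then g i else 0)"

definition closed_loop :: "real mat \<Rightarrow> real mat \<Rightarrow> real mat \<Rightarrow> real mat \<Rightarrow> real mat" where
  "closed_loop A B K G = A - B * K * G"

text \<open>The type of matrices of all sizes is not an additive monoid, so finite sums of
  \<open>n \<times> n\<close> matrices are taken in the module of matrices of that size.\<close>

definition weighted_sum :: "nat \<Rightarrow> nat set \<Rightarrow> (nat \<Rightarrow> real) \<Rightarrow> (nat \<Rightarrow> real mat) \<Rightarrow> real mat" where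
  "weighted_sum n I \<alpha> M = finsum (module_mat TYPE(real) n n) (\<lambda>i. \<alpha> i \<cdot>\<^sub>m M i) I"

end

theory Submission
  imports Defs
begin

text \<open>A convex combination of the subsystems depends on the sparsifiers only through the matrix
  \<open>\<Sum>i. \<alpha> i * G i\<close>, because the closed loop is affine in the sparsifier and the weights sum to one.
  The index blocks partition the state coordinates, so with uniform weights \<open>1 / N\<close> and all
  parameters equal to \<open>N\<close> this matrix is the identity: each coordinate is measured by one
  subsystem out of \<open>N\<close>, with an amplification that makes up for the other \<open>N - 1\<close>.
  The average is then the full-state closed loop \<open>A - B * K\<close>, which is Hurwitz for the gain
  \<open>K\<close> given by stabilizability.\<close>

lemma weighted_sum_carrier:
  assumes "\<And>i. i \<in> I \<Longrightarrow> M i \<in> carrier_mat n n"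
  shows "weighted_sum n I \<alpha> M \<in> carrier_mat n n"
proof -
  interpret abelian_monoid "module_mat TYPE(real) n n"
    by (rule abelian_group.axioms(1)[OF abelian_group_mat])
  have "weighted_sum n I \<alpha> M \<in> carrier (module_mat TYPE(real) n n)"
    unfolding weighted_sum_def using assms
    by (intro finsum_closed) (auto simp: module_mat_simps)
  then show ?thesis by (simp add: module_mat_simps)
qed

lemma index_weighted_sum:
  assumes "finite I" and "r < n" and "c < n"
    and "\<And>i. i \<in> I \<Longrightarrow> M i \<in> carrier_mat n n"
  shows "weighted_sum n I \<alpha> M $$ (r, c) = (\<Sum>i\<in>I. \<alpha> i * M i $$ (r, c))"
  using assms(1,4)
proof (induction I)
  interpret abelian_monoid "module_mat TYPE(real) n n"
    by (rule abelian_group.axioms(1)[OF abelian_group_mat])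
  case empty
  show ?case using assms(2,3) by (simp add: weighted_sum_def finsum_empty module_mat_simps)
next
  interpret abelian_monoid "module_mat TYPE(real) n n"
    by (rule abelian_group.axioms(1)[OF abelian_group_mat])
  case (insert j I)
  have "weighted_sum n (insert j I) \<alpha> M = \<alpha> j \<cdot>\<^sub>m M j + weighted_sum n I \<alpha> M"
    unfolding weighted_sum_def using insert.hyps insert.prems
    by (subst finsum_insert) (auto simp: module_mat_simps)
  moreover have "weighted_sum n I \<alpha> M \<in> carrier_mat n n" and "dim_row (M j) = n" and "dim_col (M j) = n"
    using insert.prems by (auto intro: weighted_sum_carrier)
  ultimately show ?case
    using insert assms(2,3) by (simp add: carrier_matD)
qed

text \<open>Multiplication by a diagonal matrix from the right scales columns, so a sparsifier acts on the
  entries of \<open>B * K\<close> one by one. The bound \<open>n\<close> on the last block disappears because \<open>c < n\<close>.\<close>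

lemma index_closed_loop_sparsifier:
  assumes "A \<in> carrier_mat n n" and "B \<in> carrier_mat n m" and "K \<in> carrier_mat m n"
    and "r < n" and "c < n"
  shows "closed_loop A B K (sparsifier n S g i) $$ (r, c) =
    A $$ (r, c) - (B * K) $$ (r, c) * (if (i - 1) * S \<le> c \<and> c < i * S then g i else 0)"
proof -
  have BK: "B * K \<in> carrier_mat n n" using assms by simp
  show ?thesis
    unfolding closed_loop_def sparsifier_def mat_diag_mult_right[OF BK]
    using assms by (auto simp: Suc_le_eq)
qed

text \<open>The index blocks are disjoint: the block that contains the position \<open>c\<close> can be computed
  from \<open>c\<close>. Together with the next lemma, which says that this block is among the existing ones,
  this is the partition of the coordinates that the proof rests on.\<close>

lemma block_index_iff:
  fixes S :: nat
  assumes "S > 0" and "i \<ge> 1"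
  shows "(i - 1) * S \<le> c \<and> c < i * S \<longleftrightarrow> i = Suc (c div S)"
proof -
  obtain k where k: "i = Suc k" using assms(2) by (cases i) auto
  have "k * S \<le> c \<and> c < Suc k * S \<longleftrightarrow> k \<le> c div S \<and> c div S < Suc k"
    using assms(1) by (simp only: less_eq_div_iff_mult_less_eq div_less_iff_less_mult)
  then show ?thesis using k by auto
qed

lemma block_index_le_num_sparsifiers:
  assumes "S > 0" and "c < n"
  shows "Suc (c div S) \<le> num_sparsifiers n S"
proof -
  have "real (c div S) \<le> real c / real S" by (rule of_nat_div_le_of_nat)
  also have "\<dots> < real n / real S" using assms by (simp add: divide_strict_right_mono)
  finally have "int (c div S) < \<lceil>real n / real S\<rceil>" by (simp add: less_ceiling_iff)
  then show ?thesis unfolding num_sparsifiers_def by linarith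
qed

theorem theorem2:
  fixes n m S N :: nat and A B :: "real mat"
  assumes "n > 0" and "m > 0" and "S > 0" and "S \<le> n"
    and "N = num_sparsifiers n S"
    and "A \<in> carrier_mat n n" and "B \<in> carrier_mat n m"
    and "stabilizable A B"
  shows "\<exists>(g :: nat \<Rightarrow> real) (K :: real mat) (\<alpha> :: nat \<Rightarrow> real).
    K \<in> carrier_mat m n \<and>
    (\<forall>i\<in>{1..N}. \<alpha> i \<ge> 0) \<and> (\<Sum>i=1..N. \<alpha> i) = 1 \<and>
    hurwitz (weighted_sum n {1..N} \<alpha> (\<lambda>i. closed_loop A B K (sparsifier n S g i)))"
proof -
  obtain K where K: "K \<in> carrier_mat m n" and hurwitz: "hurwitz (A - B * K)"
    using assms(6-8) unfolding stabilizable_def by auto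
  have N: "N > 0"
    using block_index_le_num_sparsifiers[OF \<open>S > 0\<close> \<open>n > 0\<close>] assms(5) by simp
  define M where "M i = closed_loop A B K (sparsifier n S (\<lambda>_. real N) i)" for i
  have M: "M i \<in> carrier_mat n n" for i
    unfolding M_def closed_loop_def sparsifier_def
    using assms(7) K by (intro minus_carrier_mat mult_carrier_mat) (auto simp: mat_diag_def)
  have "weighted_sum n {1..N} (\<lambda>_. 1 / real N) M = A - B * K"
  proof (rule eq_matI)
    fix r c assume "r < dim_row (A - B * K)" and "c < dim_col (A - B * K)"
    then have rc: "r < n" "c < n" using assms(7) K by auto
    let ?a = "A $$ (r, c)" and ?b = "(B * K) $$ (r, c)"
    have block: "Suc (c div S) \<in> {1..N}"
      using block_index_le_num_sparsifiers[OF \<open>S > 0\<close> rc(2)] assms(5) by simp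
    have "weighted_sum n {1..N} (\<lambda>_. 1 / real N) M $$ (r, c) =
        (\<Sum>i=1..N. 1 / real N * M i $$ (r, c))"
      using rc M by (intro index_weighted_sum) auto
    \<comment> \<open>Only the block of \<open>c\<close> feeds back column \<open>c\<close>, and there the weight cancels the parameter.\<close>
    also have "\<dots> = (\<Sum>i=1..N. ?a / real N - (if i = Suc (c div S) then ?b else 0))"
    proof (rule sum.cong)
      fix i assume "i \<in> {1..N}"
      then show "1 / real N * M i $$ (r, c) =
          ?a / real N - (if i = Suc (c div S) then ?b else 0)"
        unfolding M_def index_closed_loop_sparsifier[OF assms(6,7) K rc]
        using block_index_iff[OF \<open>S > 0\<close>, of i c] N by (simp add: field_simps)
    qed simp
    also have "\<dots> = ?a - ?b"
      using block N by (simp add: sum_subtractf)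
    also have "\<dots> = (A - B * K) $$ (r, c)"
      using rc assms(6,7) K by simp
    finally show "weighted_sum n {1..N} (\<lambda>_. 1 / real N) M $$ (r, c) = (A - B * K) $$ (r, c)" .
  qed (use weighted_sum_carrier[of "{1..N}" M n] M assms(6,7) K in auto)
  then have "hurwitz (weighted_sum n {1..N} (\<lambda>_. 1 / real N) M)"
    using hurwitz by simp
  then show ?thesis
    using K N unfolding M_def
    by (intro exI[of _ "\<lambda>_. real N"] exI[of _ K] exI[of _ "\<lambda>_. 1 / real N"]) simp
qed

end
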